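(* Let $q$ be a prime power and let $t$, $k_1,\ldots,k_t,n_1,\ldots,n_t$ be positive integers such that $\gcd(n_i,n_j)=1$ for each $i\ne j$ and $k_i<n_i$ for each $i\in[t]:=\{1,\ldots,t\}$. Let $m=n_1\cdots n_t$ and let $$\mathcal S_i:=\{(x,x^q,\ldots,x^{q^{k_i-1}}) : x\in\mathbb F_{q^{n_i}}\}\subseteq\mathbb F_{q^m}^{k_i},\qquad i\in[t].$$ Then $\mathcal S:=\mathcal S_1\oplus\cdots\oplus\mathcal S_t$ is a $(\Lambda_{k-1,\mathbf k},k-1)$-evasive $[n,k]_{q^m/q}$ system, where $n=n_1+\ldots+n_t$, $k=k_1+\ldots+k_t$ and $\mathbf k=(k_1,\ldots,k_t)$.
   Context: An $[n,k]_{q^m/q}$ system is an $n$-dimensional $\mathbb F_q$-subspace $\mathcal S$ of $\mathbb F_{q^m}^k$ with $\langle\mathcal S\rangle_{\mathbb F_{q^m}}=\mathbb F_{q^m}^k$. With $\mathbb F_{q^m}^k=\mathbb F_{q^m}^{k_1}\oplus\cdots\oplus\mathbb F_{q^m}^{k_t}$, $\iota_i$ denotes the embedding of $\mathbb F_{q^m}^{k_i}$ as the $i$-th summand (zeros in all other blocks), and $\mathcal S_1\oplus\cdots\oplus\mathcal S_t:=\iota_1(\mathcal S_1)+\ldots+\iota_t(\mathcal S_t)$. For a collection $\mathcal A$ of $\mathbb F_q$-subspaces of $\mathbb F_{q^m}^k$ and an integer $h\ge 0$, $\mathcal S$ is $(\mathcal A,h)$-evasive if $\dim_{\mathbb F_q}(\mathcal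 S\cap A)\le h$ for all $A\in\mathcal A$. For $0\le h\le k-1$, $$\Lambda_{h,\mathbf k}:=\{V: V \text{ is an }\mathbb F_{q^m}\text{-subspace of }\mathbb F_{q^m}^k,\ \dim_{\mathbb F_{q^m}}(V)=h,\ \iota_i(\mathbb F_{q^m}^{k_i})\not\subseteq V\text{ for all } i\in[t]\}.$$ *)

theory Defs
  imports "HOL-Library.Function_Algebras" "HOL-Library.Cardinality" "HOL-Number_Theory.Prime_Powers"
begin

text \<open>
  Throughout, the type \<open>'a\<close> plays the role of the large field and \<open>'b\<close> that of the base field,
  which acts on \<open>'a\<close> through a field embedding \<open>e :: 'b \<Rightarrow> 'a\<close>. The space \<open>'a\<^sup>d\<close> is the set of
  functions \<open>nat \<Rightarrow> 'a\<close> that vanish from index \<open>d\<close> on. Blocks and coordinates are numbered from 0.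
\<close>

definition field_embedding :: "('b::field \<Rightarrow> 'a::field) \<Rightarrow> bool" where
  "field_embedding e \<longleftrightarrow>
     e 1 = 1 \<and> (\<forall>x y. e (x + y) = e x + e y) \<and> (\<forall>x y. e (x * y) = e x * e y)"

definition is_subfield :: "'a::field set \<Rightarrow> bool" where
  "is_subfield K \<longleftrightarrow>
     0 \<in> K \<and> 1 \<in> K \<and> (\<forall>x\<in>K. \<forall>y\<in>K. x - y \<in> K \<and> x * y \<in> K) \<and> (\<forall>x\<in>K. inverse x \<in> K)"

definition ext_scale :: "('b::field \<Rightarrow> 'a::field) \<Rightarrow> 'b \<Rightarrow> (nat \<Rightarrow> 'a) \<Rightarrow> nat \<Rightarrow> 'a" where
  "ext_scale e c v = (\<lambda>j. e c * v j)"

lemma field_embedding_id: "field_embedding (\<lambda>x. x)"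
  by (simp add: field_embedding_def)

text \<open>
  Hence the library's \<open>module.subspace\<close>, \<open>module.span\<close> and \<open>vector_space.dim\<close>, instantiated with
  \<open>ext_scale e\<close> (base field) or \<open>ext_scale (\<lambda>x. x)\<close> (large field), have their intended meaning.
\<close>

lemma vector_space_ext_scale:
  assumes "field_embedding e"
  shows "vector_space (ext_scale e)"
  using assms
  by unfold_locales (auto simp: field_embedding_def ext_scale_def fun_eq_iff algebra_simps)

definition full_space :: "nat \<Rightarrow> (nat \<Rightarrow> 'a::field) set" where
  "full_space d = {v. \<forall>j\<ge>d. v j = 0}"

definition is_system ::
  "('b::field \<Rightarrow> 'a::field) \<Rightarrow> nat \<Rightarrow> nat \<Rightarrow> (nat \<Rightarrow> 'a) set \<Rightarrow> bool" where
  "is_system e n k S \<longleftrightarrow>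
     S \<subseteq> full_space k \<and>
     module.subspace (ext_scale e) S \<and>
     vector_space.dim (ext_scale e) S = n \<and>
     module.span (ext_scale (\<lambda>x. x)) S = full_space k"

definition evasive ::
  "('b::field \<Rightarrow> 'a::field) \<Rightarrow> (nat \<Rightarrow> 'a) set set \<Rightarrow> nat \<Rightarrow> (nat \<Rightarrow> 'a) set \<Rightarrow> bool" where
  "evasive e \<A> h S \<longleftrightarrow> (\<forall>A\<in>\<A>. vector_space.dim (ext_scale e) (S \<inter> A) \<le> h)"

text \<open>Block \<open>i\<close> occupies the \<open>k i\<close> coordinates starting at \<open>k 0 + \<dots> + k (i - 1)\<close>.\<close>

definition block_emb :: "(nat \<Rightarrow> nat) \<Rightarrow> nat \<Rightarrow> (nat \<Rightarrow> 'a::field) \<Rightarrow> nat \<Rightarrow> 'a" where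
  "block_emb k i x =
     (\<lambda>l. if (\<Sum>r<i. k r) \<le> l \<and> l < (\<Sum>r<i. k r) + k i then x (l - (\<Sum>r<i. k r)) else 0)"

definition direct_sum ::
  "nat \<Rightarrow> (nat \<Rightarrow> nat) \<Rightarrow> (nat \<Rightarrow> (nat \<Rightarrow> 'a::field) set) \<Rightarrow> (nat \<Rightarrow> 'a) set" where
  "direct_sum t k S = {\<Sum>i<t. block_emb k i (x i) | x. \<forall>i<t. x i \<in> S i}"

definition Lambda_spaces :: "nat \<Rightarrow> nat \<Rightarrow> (nat \<Rightarrow> nat) \<Rightarrow> (nat \<Rightarrow> 'a::field) set set" where
  "Lambda_spaces h t k =
     {V. V \<subseteq> full_space (\<Sum>i<t. k i) \<and>
         module.subspace (ext_scale (\<lambda>x. x)) V \<and>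
         vector_space.dim (ext_scale (\<lambda>x. x)) V = h \<and>
         (\<forall>i<t. \<not> block_emb k i ` full_space (k i) \<subseteq> V)}"

definition moore_space :: "nat \<Rightarrow> nat \<Rightarrow> 'a::field set \<Rightarrow> (nat \<Rightarrow> 'a) set" where
  "moore_space q d K = {(\<lambda>j. if j < d then x ^ (q ^ j) else 0) | x. x \<in> K}"

end

theory Submission
  imports Defs "HOL-Number_Theory.Residues" "HOL-Computational_Algebra.Polynomial"
begin

text \<open>
  Write \<open>L\<close> for the large field, \<open>L\<^sub>0\<close> for the image of the base field (the elements with
  \<open>y\<^sup>q = y\<close>), and \<open>\<phi>\<close> for the map \<open>y \<mapsto> y\<^sup>q\<close>. A vector of the system is determined by a tuple
  \<open>x = (x\<^sub>i)\<close> with \<open>x\<^sub>i \<in> F i\<close>; its coordinates are the powers \<open>\<phi>\<^sup>s x\<^sub>i\<close> with \<open>s < k i\<close>.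

  That it is a system is a matter of counting. The tuple can be read off the coordinates with
  \<open>s = 0\<close>, so there are \<open>q\<close> to the power \<open>\<Sum>i<t. n i\<close> vectors, which gives the dimension. A linear
  form over \<open>L\<close> that vanishes on all of them yields, block by block, a polynomial
  \<open>\<Sum>s. a s * X ^ (q ^ s)\<close> with \<open>q ^ n i\<close> roots and smaller degree, so the form is zero and the
  vectors span.

  For evasiveness, let \<open>A\<close> be a hyperplane containing no full block. It is killed by a linear form
  \<open>a\<close> with a nonzero coefficient in every block. The point is that vectors of the system lying
  in \<open>A\<close> that are independent over \<open>L\<^sub>0\<close> are still independent over \<open>L\<close>; the dimension of the
  intersection over \<open>L\<^sub>0\<close> is then at most the dimension of \<open>A\<close> over \<open>L\<close>. This is Galois descent
  (Artin's argument): if the space of \<open>L\<close>-linear relations among the vectors is mapped into itself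
  by automorphisms that together fix only \<open>L\<^sub>0\<close>, then a nonzero relation of minimal support,
  scaled to have an entry 1, has all its entries in \<open>L\<^sub>0\<close>.

  The automorphisms come from coprimality of the degrees \<open>n i\<close>. By the Chinese remainder theorem some
  power \<open>\<sigma>\<close> of \<open>\<phi>\<close> is the inverse of \<open>\<phi>\<close> on \<open>F i\<close> and the identity on every other \<open>F j\<close>.
  Applied to a relation \<open>\<Sum>v. c v * \<phi>\<^sup>s (x\<^sub>v\<^sub>,\<^sub>i) = 0\<close> it gives the relation with \<open>\<sigma> (c v)\<close> and
  \<open>s - 1\<close>, while in the other blocks \<open>s\<close> does not change. So \<open>\<sigma> \<circ> c\<close> is again a relation, as soon as the relations \<open>c\<close> also hold for the one missing
  exponent \<open>s = k i\<close>. This is where the linear form is used: apply to \<open>a(x) = 0\<close> the power of \<open>\<phi>\<close>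
  that acts trivially on the blocks other than \<open>i\<close> and raises the top exponent occurring in block
  \<open>i\<close> exactly to \<open>k i\<close>. All the other terms use coordinates already present, so
  \<open>\<phi>\<close> to the power \<open>k i\<close> of \<open>x\<^sub>i\<close> is a combination of the coordinates of the vector, with coefficients
  that are the same for all vectors in \<open>A\<close>. See \<open>relation_next_frobenius_power\<close>,
  \<open>relation_over_base_field\<close> and \<open>independent_over_extension\<close>.
\<close>

section \<open>Frobenius powers and subfields of a finite field\<close>

lemma frobenius_power_sum:
  fixes f :: "'i \<Rightarrow> 'a::{field,finite}"
  assumes "q = CHAR('a) ^ r"
  shows "(\<Sum>i\<in>A. f i) ^ q ^ h = (\<Sum>i\<in>A. f i ^ q ^ h)"
proof (rule freshmans_dream_sum')
  show "prime CHAR('a)"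
    by (simp add: prime_CHAR_semidom finite_imp_CHAR_pos)
  show "q ^ h = CHAR('a) ^ (r * h)"
    by (simp add: assms power_mult)
qed

lemma char_power_if_card:
  assumes "primepow q" "CARD('a::{field,finite}) = q ^ m"
  shows "\<exists>r. q = CHAR('a) ^ r"
proof -
  obtain p r where p: "prime p" "q = p ^ r"
    using assms(1) unfolding primepow_def by blast
  have pc: "prime CHAR('a)"
    by (simp add: prime_CHAR_semidom finite_imp_CHAR_pos)
  have "CHAR('a) dvd p ^ (r * m)"
    using CHAR_dvd_CARD[where 'a='a] assms(2) p by (simp add: power_mult)
  hence "CHAR('a) = p"
    using pc p(1) by (meson prime_dvd_power primes_dvd_imp_eq)
  with p show ?thesis by blast
qed

text \<open>
  Lagrange's theorem for the multiplicative group of \<open>K\<close>, in its elementary form: multiplication by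
  \<open>x\<close> permutes the nonzero elements of \<open>K\<close>, so it does not change their product.
\<close>

lemma subfield_power_card:
  fixes K :: "'a::{field,finite} set"
  assumes K: "is_subfield K" and x: "x \<in> K"
  shows "x ^ card K = x"
proof (cases "x = 0")
  case True
  have "card K > 0" using x by (auto simp: card_gt_0_iff)
  with True show ?thesis by simp
next
  case False
  have "(\<Prod>y\<in>K-{0}. x * y) = (\<Prod>y\<in>K-{0}. y)"
    by (rule prod.reindex_bij_witness[of _ "\<lambda>y. inverse x * y" "\<lambda>y. x * y"])
      (use False K x in \<open>auto simp: is_subfield_def\<close>)
  hence "x ^ card (K - {0}) * \<Prod>(K - {0}) = 1 * \<Prod>(K - {0})"
    by (simp add: prod.distrib)
  moreover have "\<Prod>(K - {0}) \<noteq> 0" by simp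
  ultimately have "x ^ card (K - {0}) = 1" by (metis mult_cancel_right)
  moreover have "card K = Suc (card (K - {0}))"
    using K card.remove[of K 0] by (simp add: is_subfield_def)
  ultimately show ?thesis by simp
qed

text \<open>
  These are the roots of \<open>X ^ Q - X\<close>.
\<close>

lemma card_fixed_points_power_le:
  assumes "Q > 1"
  shows "card {x::'a::{field,finite}. x ^ Q = x} \<le> Q"
proof -
  define p :: "'a poly" where "p = monom 1 Q - monom 1 1"
  have c: "coeff p Q = 1" using assms by (simp add: p_def)
  hence "p \<noteq> 0" by auto
  have "degree p \<le> Q"
    unfolding p_def using assms by (intro degree_diff_le) (auto simp: degree_monom_eq)
  moreover have "{x::'a. x ^ Q = x} = {x. poly p x = 0}"
    by (auto simp: p_def poly_monom)
  ultimately show ?thesis using card_poly_roots_bound[OF \<open>p \<noteq> 0\<close>] by simp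
qed

lemma subfield_eq_fixed_points:
  fixes K :: "'a::{field,finite} set"
  assumes K: "is_subfield K"
  shows "K = {x. x ^ card K = x}"
proof (rule card_seteq)
  have "card {0, 1::'a} \<le> card K"
    by (rule card_mono) (use K in \<open>auto simp: is_subfield_def\<close>)
  thus "card {x::'a. x ^ card K = x} \<le> card K"
    by (intro card_fixed_points_power_le) simp
qed (use subfield_power_card[OF K] in auto)

text \<open>
  Exponents of the Frobenius map matter only modulo the degree of the subfield. A single power
  of Frobenius can therefore act in prescribed ways on several subfields of coprime degrees.
\<close>

lemma frobenius_power_cong:
  fixes x :: "'a::field"
  assumes "x ^ q ^ n = x" "[a = b] (mod n)"
  shows "x ^ q ^ a = x ^ q ^ b"
proof -
  have mult: "x ^ q ^ (n * j) = x" for j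
    by (induction j) (simp_all add: power_add power_mult assms(1))
  have "x ^ q ^ c = x ^ q ^ (c mod n)" for c
  proof -
    have "x ^ q ^ c = x ^ q ^ (n * (c div n) + c mod n)" by simp
    also have "\<dots> = (x ^ q ^ (n * (c div n))) ^ q ^ (c mod n)"
      by (simp only: power_add power_mult)
    finally show ?thesis by (simp only: mult)
  qed
  thus ?thesis using assms(2) unfolding cong_def by metis
qed

lemma embedded_field_eq_fixed_points:
  fixes e :: "'b::{field,finite} \<Rightarrow> 'a::{field,finite}"
  assumes e: "field_embedding e"
  shows "range e = {x. x ^ CARD('b) = x}"
proof -
  have add: "e (x + y) = e x + e y" and mult: "e (x * y) = e x * e y" and one: "e 1 = 1" for x y
    using e by (auto simp: field_embedding_def)
  have zero: "e 0 = 0" by (metis add add_cancel_right_right add_0)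
  have diff: "e (x - y) = e x - e y" for x y using add[of "x - y" y] by simp
  have ne: "e x \<noteq> 0" if "x \<noteq> 0" for x using mult[of x "inverse x"] one that by auto
  have inv: "e (inverse x) = inverse (e x)" for x
  proof (cases "x = 0")
    case False
    thus ?thesis using mult[of x "inverse x"] one ne by (simp add: inverse_unique)
  qed (simp add: zero)
  have "inj e" using diff ne by (metis eq_iff_diff_eq_0 injI)
  hence "card (range e) = CARD('b)" by (rule card_image)
  moreover have "is_subfield (range e)"
    unfolding is_subfield_def
    using zero one by (auto simp flip: diff mult inv simp: image_iff)
  ultimately show ?thesis using subfield_eq_fixed_points[of "range e"] by simp
qed

section \<open>Descent of linear relations\<close>

text \<open>
  Artin's argument. Take a nonzero member of \<open>R\<close> with minimal support in \<open>B\<close>, scaled to take the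
  value 1 somewhere. Subtracting it from its image under \<open>T\<close> keeps the support within the old one and
  kills that value, so by minimality the difference vanishes on \<open>B\<close>.
\<close>

lemma minimal_support_fixed:
  fixes R :: "('i \<Rightarrow> 'a::field) set"
  assumes "finite B" "c0 \<in> R" "v0 \<in> B" "c0 v0 \<noteq> 0"
    and diff: "\<And>c d. c \<in> R \<Longrightarrow> d \<in> R \<Longrightarrow> (\<lambda>v. c v - d v) \<in> R"
    and scale: "\<And>\<alpha> c. c \<in> R \<Longrightarrow> (\<lambda>v. \<alpha> * c v) \<in> R"
    and T: "\<And>T. T \<in> \<T> \<Longrightarrow> T 0 = 0 \<and> T 1 = 1"
    and closed: "\<And>T c. T \<in> \<T> \<Longrightarrow> c \<in> R \<Longrightarrow> (\<lambda>v. T (c v)) \<in> R"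
  shows "\<exists>c\<in>R. (\<exists>v\<in>B. c v \<noteq> 0) \<and> (\<forall>T\<in>\<T>. \<forall>v\<in>B. T (c v) = c v)"
proof -
  define supp where "supp c = {v\<in>B. c v \<noteq> 0}" for c :: "'i \<Rightarrow> 'a"
  define P where "P c \<longleftrightarrow> c \<in> R \<and> supp c \<noteq> {}" for c
  have "P c0" using assms(2-4) by (auto simp: P_def supp_def)
  then obtain c where c: "P c" and min: "\<And>d. P d \<Longrightarrow> card (supp c) \<le> card (supp d)"
    using ex_has_least_nat[of P c0 "\<lambda>c. card (supp c)"] by auto
  obtain w where w: "w \<in> B" "c w \<noteq> 0" using c by (auto simp: P_def supp_def)
  define d where "d v = inverse (c w) * c v" for v
  have d: "d \<in> R" "d w = 1" using c w scale by (auto simp: P_def d_def[abs_def])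
  have "T (d v) = d v" if "T \<in> \<T>" "v \<in> B" for T v
  proof (rule ccontr)
    assume ne: "T (d v) \<noteq> d v"
    let ?f = "\<lambda>v. T (d v) - d v"
    have "?f \<in> R" using diff closed that d by blast
    hence "P ?f" using ne that by (auto simp: P_def supp_def)
    moreover have "supp ?f \<subset> supp c"
    proof (rule psubsetI)
      show "supp ?f \<subseteq> supp c" using T[OF that(1)] by (auto simp: supp_def d_def)
      have "w \<notin> supp ?f" using d(2) T[OF that(1)] by (simp add: supp_def)
      moreover have "w \<in> supp c" using w by (simp add: supp_def)
      ultimately show "supp ?f \<noteq> supp c" by blast
    qed
    moreover have "finite (supp c)" using \<open>finite B\<close> by (simp add: supp_def)
    ultimately show False using min psubset_card_mono by (metis not_le)
  qed
  with d w show ?thesis by (intro bexI[of _ d] conjI bexI[of _ w]) auto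
qed

lemma coprime_residue_selector:
  fixes n :: "nat \<Rightarrow> nat"
  assumes "\<forall>i<t. \<forall>j<t. i \<noteq> j \<longrightarrow> coprime (n i) (n j)" and "i < t"
  shows "\<exists>h. [h = r] (mod n i) \<and> (\<forall>j<t. j \<noteq> i \<longrightarrow> [h = 0] (mod n j))"
proof -
  obtain h where h: "\<forall>j\<in>{..<t}. [h = (if j = i then r else 0)] (mod n j)"
    using chinese_remainder_nat[of "{..<t}" n "\<lambda>j. if j = i then r else 0"] assms by auto
  show ?thesis
    by (rule exI[of _ h]) (use h assms in \<open>auto split: if_splits\<close>)
qed

text \<open>
  Consider the last nonzero coefficient \<open>a i d\<close> of block \<open>i\<close>. A Frobenius power that
  acts as the \<open>k i - d\<close>-th one on component \<open>i\<close> and trivially on the others turns the linear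
  equation satisfied by every \<open>x v\<close> into one whose top term in block \<open>i\<close> has exponent \<open>k i\<close>, while
  all other exponents stay in the range covered by the hypothesis on \<open>c\<close>.
\<close>

lemma relation_next_frobenius_power:
  fixes x :: "'v \<Rightarrow> nat \<Rightarrow> 'a::{field,finite}"
  assumes q: "q = CHAR('a) ^ r"
    and coprime: "\<forall>i<t. \<forall>j<t. i \<noteq> j \<longrightarrow> coprime (n i) (n j)"
    and x: "\<And>v i. v \<in> B \<Longrightarrow> i < t \<Longrightarrow> x v i ^ q ^ n i = x v i"
    and functional: "\<And>v. v \<in> B \<Longrightarrow> (\<Sum>i<t. \<Sum>s<k i. a i s * x v i ^ q ^ s) = 0"
    and a: "i < t" "\<exists>s<k i. a i s \<noteq> 0"
    and c: "\<And>j s. j < t \<Longrightarrow> s < k j \<Longrightarrow> (\<Sum>v\<in>B. c v * x v j ^ q ^ s) = 0"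
  shows "(\<Sum>v\<in>B. c v * x v i ^ q ^ k i) = 0"
proof -
  let ?T = "{s. s < k i \<and> a i s \<noteq> 0}"
  have fin: "finite ?T" and ne: "?T \<noteq> {}" using a by auto
  define d where "d = Max ?T"
  have d: "d < k i" "a i d \<noteq> 0" using Max_in[OF fin ne] by (auto simp: d_def)
  have top: "a i s = 0" if "s < k i" "d < s" for s
    using Max_ge[OF fin, of s] that unfolding d_def by (metis (mono_tags, lifting) leD mem_Collect_eq)
  obtain h where h: "[h = k i - d] (mod n i)" "\<And>j. j < t \<Longrightarrow> j \<noteq> i \<Longrightarrow> [h = 0] (mod n j)"
    using coprime_residue_selector[OF coprime a(1)] by metis
  \<comment> \<open>the exponent into which the chosen Frobenius power turns exponent \<open>s\<close> on component \<open>j\<close>\<close>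
  define w where "w j s = (if j = i then s + (k i - d) else s)" for j s
  have pow: "x v j ^ q ^ (s + h) = x v j ^ q ^ w j s" if "v \<in> B" "j < t" for v j s
  proof (rule frobenius_power_cong[OF x[OF that]])
    show "[s + h = w j s] (mod n j)"
      using cong_add[OF cong_refl[of s] h(1)] cong_add[OF cong_refl[of s] h(2)[OF that(2)]]
      by (cases "j = i") (simp_all add: w_def)
  qed
  define X where "X j s = (\<Sum>v\<in>B. c v * x v j ^ q ^ s)" for j s
  have "0 = (\<Sum>v\<in>B. c v * (\<Sum>j<t. \<Sum>s<k j. a j s * x v j ^ q ^ s) ^ q ^ h)"
  proof -
    have "q > 0" unfolding q by (simp add: finite_imp_CHAR_pos)
    thus ?thesis using functional by (simp add: power_0_left)
  qed
  also have "\<dots> = (\<Sum>v\<in>B. c v * (\<Sum>j<t. \<Sum>s<k j. a j s ^ q ^ h * x v j ^ q ^ w j s))"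
  proof (intro sum.cong refl arg_cong2[where f="(*)"])
    fix v assume v: "v \<in> B"
    have "(x v j ^ q ^ s) ^ q ^ h = x v j ^ q ^ w j s" if "j < t" for j s
      using pow[OF v that, of s] by (simp add: power_add power_mult)
    thus "(\<Sum>j<t. \<Sum>s<k j. a j s * x v j ^ q ^ s) ^ q ^ h
        = (\<Sum>j<t. \<Sum>s<k j. a j s ^ q ^ h * x v j ^ q ^ w j s)"
      by (simp add: frobenius_power_sum[OF q] power_mult_distrib)
  qed
  also have "\<dots> = (\<Sum>j<t. \<Sum>s<k j. a j s ^ q ^ h * X j (w j s))"
    unfolding X_def sum_distrib_left
    by (subst sum.swap, rule sum.cong[OF refl], subst sum.swap)
      (simp add: mult_ac)
  also have "\<dots> = (\<Sum>j<t. if j = i then a i d ^ q ^ h * X i (k i) else 0)"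
  proof (rule sum.cong[OF refl])
    fix j assume "j \<in> {..<t}"
    show "(\<Sum>s<k j. a j s ^ q ^ h * X j (w j s)) = (if j = i then a i d ^ q ^ h * X i (k i) else 0)"
    proof (cases "j = i")
      case False
      thus ?thesis using \<open>j \<in> {..<t}\<close> c by (auto simp: w_def X_def)
    next
      case True
      have "q > 0" unfolding q by (simp add: finite_imp_CHAR_pos)
      have "a i s ^ q ^ h * X i (w i s) = (if s = d then a i d ^ q ^ h * X i (k i) else 0)"
        if "s < k i" for s
      proof -
        consider "s < d" | "s = d" | "d < s" by linarith
        thus ?thesis
        proof cases
          case 1
          hence "w i s < k i" using d by (simp add: w_def)
          thus ?thesis using 1 c a(1) by (simp add: X_def)
        next
          case 2
          thus ?thesis using d by (simp add: w_def)
        next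
          case 3
          thus ?thesis using top that \<open>q > 0\<close> by (simp add: power_0_left)
        qed
      qed
      thus ?thesis using True d by (simp add: sum.delta)
    qed
  qed
  also have "\<dots> = a i d ^ q ^ h * X i (k i)"
    using a(1) by (simp add: sum.delta)
  finally show ?thesis using d by (simp add: X_def)
qed

text \<open>
  The relations are stable under the Frobenius powers with exponent \<open>g i\<close>, which undo one Frobenius on
  component \<open>i\<close> and leave the other components alone. Fixed by all of them, an entry of a
  relation is fixed by their composite, whose exponent is \<open>-1\<close> modulo every \<open>n i\<close> and hence modulo
  their product: the composite is the inverse of Frobenius.
\<close>

lemma relation_over_base_field:
  fixes x :: "'v \<Rightarrow> nat \<Rightarrow> 'a::{field,finite}"
  assumes q: "q = CHAR('a) ^ r"
    and coprime: "\<forall>i<t. \<forall>j<t. i \<noteq> j \<longrightarrow> coprime (n i) (n j)"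
    and n: "\<And>i. i < t \<Longrightarrow> n i > 0"
    and UNIV: "\<And>y::'a. y ^ q ^ (\<Prod>i<t. n i) = y"
    and k: "\<And>i. i < t \<Longrightarrow> k i > 0"
    and x: "\<And>v i. v \<in> B \<Longrightarrow> i < t \<Longrightarrow> x v i ^ q ^ n i = x v i"
    and functional: "\<And>v. v \<in> B \<Longrightarrow> (\<Sum>i<t. \<Sum>s<k i. a i s * x v i ^ q ^ s) = 0"
    and a: "\<And>i. i < t \<Longrightarrow> \<exists>s<k i. a i s \<noteq> 0"
    and B: "finite B" "v0 \<in> B" "c0 v0 \<noteq> 0"
    and c0: "\<And>j s. j < t \<Longrightarrow> s < k j \<Longrightarrow> (\<Sum>v\<in>B. c0 v * x v j ^ q ^ s) = 0"
  shows "\<exists>c. (\<exists>v\<in>B. c v \<noteq> 0) \<and> (\<forall>v\<in>B. c v ^ q = c v) \<and>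
    (\<forall>j<t. \<forall>s<k j. (\<Sum>v\<in>B. c v * x v j ^ q ^ s) = 0)"
proof -
  define R where "R = {c. \<forall>j<t. \<forall>s<k j. (\<Sum>v\<in>B. c v * x v j ^ q ^ s) = 0}"
  have qpos: "q > 0" unfolding q by (simp add: finite_imp_CHAR_pos)
  have "\<exists>h. [h = n i - 1] (mod n i) \<and> (\<forall>j<t. j \<noteq> i \<longrightarrow> [h = 0] (mod n j))" if "i < t" for i
    using coprime_residue_selector[OF coprime that] .
  then obtain g where g: "\<And>i. i < t \<Longrightarrow> [g i = n i - 1] (mod n i)"
      "\<And>i j. i < t \<Longrightarrow> j < t \<Longrightarrow> j \<noteq> i \<Longrightarrow> [g i = 0] (mod n j)"
    by metis
  have closed: "(\<lambda>v. c v ^ q ^ g i) \<in> R" if c: "c \<in> R" and i: "i < t" for c i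
    unfolding R_def
  proof (intro CollectI allI impI)
    fix j s assume j: "j < t" and s: "s < k j"
    \<comment> \<open>the exponent from which the Frobenius power \<open>g i\<close> leads to \<open>s\<close>; it may be the missing one \<open>k i\<close>\<close>
    define s' where "s' = (if j = i then Suc s else s)"
    have eq: "(x v j ^ q ^ s') ^ q ^ g i = x v j ^ q ^ s" if v: "v \<in> B" for v
    proof -
      have "[s' + g i = s] (mod n j)"
      proof (cases "j = i")
        case True
        have "[Suc s + g i = Suc s + (n i - 1)] (mod n i)"
          using g(1)[OF i] by (intro cong_add cong_refl)
        moreover have "Suc s + (n i - 1) = s + n i" using n[OF i] by simp
        ultimately show ?thesis using True by (simp add: s'_def cong_def)
      next
        case False
        thus ?thesis using cong_add[OF cong_refl[of s] g(2)[OF i j]] by (simp add: s'_def)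
      qed
      thus ?thesis using frobenius_power_cong[OF x[OF v j]] by (metis power_add power_mult)
    qed
    have "(\<Sum>v\<in>B. c v * x v j ^ q ^ s') = 0"
    proof (cases "s' < k j")
      case True
      thus ?thesis using c j by (simp add: R_def)
    next
      case False
      hence "s' = k j" using s by (auto simp: s'_def split: if_splits)
      thus ?thesis
        using relation_next_frobenius_power[where B=B and c=c, OF q coprime x functional j a[OF j]] c
        by (simp add: R_def)
    qed
    hence "0 = (\<Sum>v\<in>B. c v * x v j ^ q ^ s') ^ q ^ g i"
      using qpos by (simp add: power_0_left)
    also have "\<dots> = (\<Sum>v\<in>B. c v ^ q ^ g i * x v j ^ q ^ s)"
      using eq by (simp add: frobenius_power_sum[OF q] power_mult_distrib)
    finally show "(\<Sum>v\<in>B. c v ^ q ^ g i * x v j ^ q ^ s) = 0" by simp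
  qed
  have "\<exists>c\<in>R. (\<exists>v\<in>B. c v \<noteq> 0) \<and>
      (\<forall>T\<in>(\<lambda>i y. y ^ q ^ g i) ` {..<t}. \<forall>v\<in>B. T (c v) = c v)"
  proof (rule minimal_support_fixed[where ?c0.0 = c0 and ?v0.0 = v0])
    show "c0 \<in> R" using c0 by (simp add: R_def)
    show "(\<lambda>v. c v - d v) \<in> R" if "c \<in> R" "d \<in> R" for c d
      using that by (simp add: R_def left_diff_distrib sum_subtractf)
    show "(\<lambda>v. \<alpha> * c v) \<in> R" if "c \<in> R" for \<alpha> c
      using that by (simp add: R_def mult.assoc flip: sum_distrib_left)
  qed (use closed qpos B in \<open>auto simp: power_0_left\<close>)
  then obtain c v where c: "c \<in> R" "v \<in> B" "c v \<noteq> 0"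
    and fixed: "\<And>i v. i < t \<Longrightarrow> v \<in> B \<Longrightarrow> c v ^ q ^ g i = c v"
    by auto
  have "c v ^ q = c v" if v: "v \<in> B" for v
  proof -
    define G where "G = (\<Sum>i<t. g i)"
    have "c v ^ q ^ (\<Sum>i<u. g i) = c v" if "u \<le> t" for u
      using that by (induction u) (simp_all add: power_add power_mult fixed v)
    hence G: "c v ^ q ^ G = c v" by (simp add: G_def)
    have "[Suc G = 0] (mod (\<Prod>i<t. n i))"
    proof (rule coprime_cong_prod_nat)
      fix i assume i: "i \<in> {..<t}"
      have "[(\<Sum>j<t. g j) = (\<Sum>j<t. if j = i then n i - 1 else 0)] (mod n i)"
        by (rule cong_sum) (use g i in auto)
      hence "[Suc G = Suc (n i - 1)] (mod n i)"
        using i cong_add[OF cong_refl[of 1]] by (fastforce simp: G_def)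
      moreover have "[Suc (n i - 1) = 0] (mod n i)"
        using n i by (simp add: cong_def)
      ultimately show "[Suc G = 0] (mod n i)" by (rule cong_trans)
    qed (use coprime in auto)
    from frobenius_power_cong[OF UNIV this] have "c v ^ q ^ Suc G = c v" by simp
    moreover have "c v ^ q ^ Suc G = (c v ^ q ^ G) ^ q"
      by (metis power_Suc2 power_mult)
    ultimately show ?thesis using G by simp
  qed
  with c show ?thesis unfolding R_def by blast
qed

section \<open>Linear algebra over a finite field\<close>

lemma card_subspace:
  fixes e :: "'b::{field,finite} \<Rightarrow> 'a::{field,finite}"
  assumes e: "field_embedding e" and W: "module.subspace (ext_scale e) W" "finite W"
  shows "card W = CARD('b) ^ vector_space.dim (ext_scale e) W"
proof -
  interpret V: vector_space "ext_scale e" using e by (rule vector_space_ext_scale)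
  obtain B where B: "B \<subseteq> W" "V.independent B" "W \<subseteq> V.span B" "card B = V.dim W"
    by (rule V.basis_exists)
  have fin: "finite B" using B(1) W(2) by (rule finite_subset)
  have span: "V.span B = W"
    using B(1,3) V.span_minimal[OF B(1) W(1)] by blast
  let ?f = "\<lambda>u. \<Sum>v\<in>B. ext_scale e (u v) v"
  have "bij_betw ?f (B \<rightarrow>\<^sub>E UNIV) W"
    unfolding bij_betw_def
  proof
    show "inj_on ?f (B \<rightarrow>\<^sub>E UNIV)"
    proof (rule inj_onI)
      fix u w assume u: "u \<in> B \<rightarrow>\<^sub>E UNIV" "w \<in> B \<rightarrow>\<^sub>E UNIV" and eq: "?f u = ?f w"
      have zero: "(\<Sum>v\<in>B. ext_scale e (u v - w v) v) = 0"
        using eq by (simp add: V.scale_left_diff_distrib sum_subtractf)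
      have "u v = w v" if "v \<in> B" for v
        using V.independentD[OF B(2) fin subset_refl zero that] by simp
      thus "u = w" using u by (intro PiE_ext)
    qed
    have "?f ` (B \<rightarrow>\<^sub>E UNIV) = range ?f"
    proof -
      have "?f u \<in> ?f ` (B \<rightarrow>\<^sub>E UNIV)" for u
        by (rule image_eqI[of _ _ "restrict u B"]) (auto intro!: sum.cong)
      thus ?thesis by blast
    qed
    thus "?f ` (B \<rightarrow>\<^sub>E UNIV) = W" using span V.span_finite[OF fin] by simp
  qed
  hence "card W = card (B \<rightarrow>\<^sub>E (UNIV :: 'b set))" by (simp add: bij_betw_same_card)
  also have "\<dots> = CARD('b) ^ card B" using fin by (simp add: card_PiE)
  finally show ?thesis using B(4) by simp
qed

lemma full_space_bij:
  "bij_betw (\<lambda>f l. if l < d then f l else 0) ({..<d} \<rightarrow>\<^sub>E (UNIV :: 'a::field set)) (full_space d)"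
proof (rule bij_betwI[where g = "\<lambda>v. restrict v {..<d}"])
  show "restrict (\<lambda>l. if l < d then f l else 0) {..<d} = f" if "f \<in> {..<d} \<rightarrow>\<^sub>E (UNIV :: 'a set)" for f
    using that by (intro PiE_ext[where k = "{..<d}" and s = "\<lambda>_. UNIV"]) simp_all
  show "(\<lambda>l. if l < d then restrict v {..<d} l else 0) = v" if "v \<in> full_space d" for v :: "nat \<Rightarrow> 'a"
    using that unfolding full_space_def fun_eq_iff by (simp add: restrict_def)
qed (simp_all add: full_space_def)

lemma finite_full_space: "finite (full_space d :: (nat \<Rightarrow> 'a::{field,finite}) set)"
  using bij_betw_finite[OF full_space_bij[of d, where 'a='a]] by (simp add: finite_PiE)

lemma card_full_space: "card (full_space d :: (nat \<Rightarrow> 'a::{field,finite}) set) = CARD('a) ^ d"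
  using bij_betw_same_card[OF full_space_bij[of d, where 'a='a]] by (simp add: card_PiE)

lemma subspace_full_space: "module.subspace (ext_scale (\<lambda>x. x)) (full_space d)"
proof -
  interpret V: vector_space "ext_scale (\<lambda>x::'a. x)"
    by (rule vector_space_ext_scale[OF field_embedding_id])
  show ?thesis by (auto simp: V.subspace_def full_space_def ext_scale_def)
qed

lemma subspace_eq_full_space:
  fixes V :: "(nat \<Rightarrow> 'a::{field,finite}) set"
  assumes "V \<subseteq> full_space d" "module.subspace (ext_scale (\<lambda>x. x)) V"
    "vector_space.dim (ext_scale (\<lambda>x. x)) V = d"
  shows "V = full_space d"
proof (rule card_subset_eq[OF finite_full_space assms(1)])
  have "finite V" using assms(1) finite_full_space by (rule finite_subset)
  thus "card V = card (full_space d :: (nat \<Rightarrow> 'a) set)"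
    using card_subspace[OF field_embedding_id assms(2)] assms(3) by (simp add: card_full_space)
qed

text \<open>
  Extend a basis of \<open>V\<close> by \<open>w\<close>, define a linear functional by its values 0 and 1 there, and read off
  its coefficients on the unit vectors.
\<close>

lemma proper_subspace_annihilator:
  fixes V :: "(nat \<Rightarrow> 'a::field) set"
  assumes V: "module.subspace (ext_scale (\<lambda>x. x)) V"
    and w: "w \<in> full_space d" "w \<notin> V"
  shows "\<exists>a. (\<forall>v\<in>V \<inter> full_space d. (\<Sum>l<d. a l * v l) = 0) \<and> (\<Sum>l<d. a l * w l) = 1"
proof -
  interpret V: vector_space "ext_scale (\<lambda>x::'a. x)"
    by (rule vector_space_ext_scale[OF field_embedding_id])
  interpret P: vector_space_pair "ext_scale (\<lambda>x::'a. x)" "(*) :: 'a \<Rightarrow> 'a \<Rightarrow> 'a"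
    by unfold_locales (simp_all add: algebra_simps)
  obtain B where B: "B \<subseteq> V" "V.independent B" "V \<subseteq> V.span B"
    by (rule V.maximal_independent_subset)
  have span: "V.span B = V" using B V.span_minimal[OF B(1) V] by blast
  have ind: "V.independent (insert w B)"
    using B(2) w(2) span by (intro V.independent_insertI) auto
  obtain g where g: "Vector_Spaces.linear (ext_scale (\<lambda>x. x)) (*) g"
    "\<forall>x\<in>insert w B. g x = (if x = w then 1 else 0)"
    using P.linear_independent_extend[OF ind, of "\<lambda>x. if x = w then 1 else 0"] by blast
  interpret g: Vector_Spaces.linear "ext_scale (\<lambda>x. x)" "(*)" g by (rule g(1))
  define \<delta> :: "nat \<Rightarrow> nat \<Rightarrow> 'a" where "\<delta> l j = (if j = l then 1 else 0)" for l j
  have rep: "g v = (\<Sum>l<d. g (\<delta> l) * v l)" if "v \<in> full_space d" for v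
  proof -
    have "v = (\<Sum>l<d. ext_scale (\<lambda>x. x) (v l) (\<delta> l))"
    proof
      fix j
      have "(\<Sum>l<d. ext_scale (\<lambda>x. x) (v l) (\<delta> l)) j = (\<Sum>l<d. if j = l then v l else 0)"
        by (induction d) (auto simp: ext_scale_def \<delta>_def)
      also have "\<dots> = v j" using that by (auto simp: full_space_def)
      finally show "v j = (\<Sum>l<d. ext_scale (\<lambda>x. x) (v l) (\<delta> l)) j" by simp
    qed
    hence "g v = g (\<Sum>l<d. ext_scale (\<lambda>x. x) (v l) (\<delta> l))" by simp
    also have "\<dots> = (\<Sum>l<d. g (\<delta> l) * v l)" by (simp add: g.sum g.scale mult.commute)
    finally show ?thesis .
  qed
  have "g v = 0" if "v \<in> V" for v
  proof (rule g.eq_0_on_span)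
    show "v \<in> V.span B" using that span by simp
    show "g b = 0" if "b \<in> B" for b using that g(2) B(1) w(2) by auto
  qed
  hence "\<forall>v\<in>V \<inter> full_space d. (\<Sum>l<d. g (\<delta> l) * v l) = 0" using rep by (metis IntE)
  moreover have "(\<Sum>l<d. g (\<delta> l) * w l) = 1" using g(2) rep[OF w(1)] by simp
  ultimately show ?thesis by (intro exI[of _ "\<lambda>l. g (\<delta> l)"] conjI)
qed

section \<open>Block coordinates\<close>

lemma block_end_le: "(\<Sum>r<i. k r) + k i \<le> (\<Sum>r<j. k r)" if "i < j" for k :: "nat \<Rightarrow> nat"
proof -
  have "(\<Sum>r<i. k r) + k i = (\<Sum>r<Suc i. k r)" by simp
  also have "\<dots> \<le> (\<Sum>r<j. k r)" using that by (intro sum_mono2) auto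
  finally show ?thesis .
qed

lemma block_coordinate:
  fixes k :: "nat \<Rightarrow> nat"
  assumes "l < (\<Sum>i<t. k i)"
  obtains i s where "i < t" "s < k i" "l = (\<Sum>r<i. k r) + s"
  using assms
proof (induction t arbitrary: thesis)
  case (Suc t)
  show ?case
  proof (cases "l < (\<Sum>i<t. k i)")
    case True
    with Suc.IH Suc.prems(1) show ?thesis by (metis less_SucI)
  next
    case False
    with Suc.prems show ?thesis
      by (intro Suc.prems(1)[of t "l - (\<Sum>i<t. k i)"]) auto
  qed
qed simp

lemma sum_over_blocks:
  fixes k :: "nat \<Rightarrow> nat" and f :: "nat \<Rightarrow> 'a::comm_monoid_add"
  shows "(\<Sum>l<\<Sum>i<t. k i. f l) = (\<Sum>i<t. \<Sum>s<k i. f ((\<Sum>r<i. k r) + s))"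
proof (induction t)
  case (Suc t)
  have "(\<Sum>l<a + b. f l) = (\<Sum>l<a. f l) + (\<Sum>s<b. f (a + s))" for a b
    by (induction b) (simp_all add: add.assoc)
  thus ?case by (simp add: Suc.IH)
qed simp

lemma sum_fun_apply: "(\<Sum>i\<in>A. f i) l = (\<Sum>i\<in>A. f i l)" for f :: "'i \<Rightarrow> 'c \<Rightarrow> 'a::comm_monoid_add"
  by (induction A rule: infinite_finite_induct) auto

text \<open>
  If the form defining the hyperplane \<open>A\<close> had no nonzero coefficient in block \<open>i\<close>, it would also kill a
  vector of that block outside \<open>A\<close>. Together with \<open>A\<close> that vector spans the whole space, so the
  form would be zero.
\<close>

lemma Lambda_space_annihilator:
  fixes A :: "(nat \<Rightarrow> 'a::{field,finite}) set"
  assumes A: "A \<in> Lambda_spaces ((\<Sum>i<t. k i) - 1) t k" and pos: "(\<Sum>i<t. k i) > 0" and t: "t > 0"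
  shows "\<exists>a. (\<forall>v\<in>A. (\<Sum>l<\<Sum>i<t. k i. a l * v l) = 0) \<and>
    (\<forall>i<t. \<exists>s<k i. a ((\<Sum>r<i. k r) + s) \<noteq> 0)"
proof -
  define d where "d = (\<Sum>i<t. k i)"
  interpret V: vector_space "ext_scale (\<lambda>x::'a. x)"
    by (rule vector_space_ext_scale[OF field_embedding_id])
  have AF: "A \<subseteq> full_space d" and sub: "V.subspace A" and dim: "V.dim A = d - 1"
    and ne: "\<And>i. i < t \<Longrightarrow> \<not> block_emb k i ` full_space (k i) \<subseteq> A"
    using A by (auto simp: Lambda_spaces_def d_def)
  have emb: "block_emb k i y \<in> full_space d" if "i < t" for i and y :: "nat \<Rightarrow> 'a"
  proof -
    have "(\<Sum>r<i. k r) + k i = (\<Sum>r<Suc i. k r)" by simp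
    also have "\<dots> \<le> d" unfolding d_def using that by (intro sum_mono2) auto
    finally show ?thesis by (auto simp: full_space_def block_emb_def)
  qed
  \<comment> \<open>\<open>A\<close> has codimension one, so one more vector completes it\<close>
  have whole: "V.span (insert w A) = full_space d" if w: "w \<in> full_space d" "w \<notin> A" for w
  proof (rule subspace_eq_full_space)
    show "V.span (insert w A) \<subseteq> full_space d"
      using w AF subspace_full_space by (intro V.span_minimal) auto
    obtain B where B: "B \<subseteq> A" "V.independent B" "A \<subseteq> V.span B" "card B = V.dim A"
      by (rule V.basis_exists)
    have fin: "finite B" using B(1) AF finite_full_space by (meson finite_subset)
    have span: "V.span B = A" using B V.span_minimal[OF B(1) sub] by blast
    have "V.independent (insert w B)" using B(2) w span by (intro V.independent_insertI) auto
    moreover have "V.span (insert w B) = V.span (insert w A)"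
      using sub by (simp only: V.span_insert span V.span_eq_iff[THEN iffD2])
    moreover have "card (insert w B) = d"
      using fin B w dim pos by (subst card_insert_disjoint) (auto simp: d_def)
    ultimately show "V.dim (V.span (insert w A)) = d"
      by (metis V.dim_span_eq_card_independent)
  qed (rule V.subspace_span)
  obtain y0 where "block_emb k 0 y0 \<notin> A" using ne[OF t] by blast
  with proper_subspace_annihilator[OF sub emb[OF t]] obtain a z
    where a: "\<And>v. v \<in> A \<Longrightarrow> (\<Sum>l<d. a l * v l) = 0"
      and z: "z \<in> full_space d" "(\<Sum>l<d. a l * z l) = 1"
    using AF emb[OF t] by (metis Int_absorb2)
  have "\<exists>s<k i. a ((\<Sum>r<i. k r) + s) \<noteq> 0" if i: "i < t" for i
  proof (rule ccontr)
    assume "\<not> ?thesis"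
    hence zero: "a ((\<Sum>r<i. k r) + s) = 0" if "s < k i" for s using that by blast
    obtain y where y: "block_emb k i y \<notin> A" using ne[OF i] by blast
    let ?K = "{v. (\<Sum>l<d. a l * v l) = 0}"
    have "V.subspace ?K"
    proof (rule V.subspaceI)
      fix c :: 'a and v assume "v \<in> ?K"
      moreover have "(\<Sum>l<d. a l * (c * v l)) = c * (\<Sum>l<d. a l * v l)"
        by (simp add: sum_distrib_left mult.left_commute)
      ultimately show "ext_scale (\<lambda>x. x) c v \<in> ?K" by (simp add: ext_scale_def)
    qed (auto simp: distrib_left sum.distrib)
    moreover have "a l * block_emb k i y l = 0" for l
      using zero[of "l - (\<Sum>r<i. k r)"] by (auto simp: block_emb_def)
    hence "block_emb k i y \<in> ?K" by (intro CollectI sum.neutral ballI)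
    ultimately have "V.span (insert (block_emb k i y) A) \<subseteq> ?K"
      using a by (intro V.span_minimal) auto
    hence "z \<in> ?K" using whole[OF emb[OF i] y] z by auto
    with z show False by simp
  qed
  with a show ?thesis unfolding d_def by blast
qed

section \<open>Moore vectors\<close>

definition moore_vector ::
  "nat \<Rightarrow> nat \<Rightarrow> (nat \<Rightarrow> nat) \<Rightarrow> (nat \<Rightarrow> 'a::field) \<Rightarrow> nat \<Rightarrow> 'a" where
  "moore_vector q t k x = (\<Sum>i<t. block_emb k i (\<lambda>j. if j < k i then x i ^ q ^ j else 0))"

lemma moore_vector_nth:
  assumes "i < t" "s < k i"
  shows "moore_vector q t k x ((\<Sum>r<i. k r) + s) = x i ^ q ^ s"
proof -
  let ?l = "(\<Sum>r<i. k r) + s"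
  have "block_emb k j y ?l = (if j = i then y s else 0)" for j and y :: "nat \<Rightarrow> 'a"
    using block_end_le[of j i k] block_end_le[of i j k] assms
    by (cases i j rule: linorder_cases) (auto simp: block_emb_def)
  thus ?thesis using assms by (simp add: moore_vector_def sum_fun_apply sum.delta)
qed

lemma moore_vector_outside:
  assumes "l \<ge> (\<Sum>i<t. k i)"
  shows "moore_vector q t k x l = 0"
proof -
  have "block_emb k i y l = 0" if "i < t" for i and y :: "nat \<Rightarrow> 'a"
    using block_end_le[OF that, of k] assms by (auto simp: block_emb_def)
  thus ?thesis by (simp add: moore_vector_def sum_fun_apply)
qed

lemma block_ext:
  fixes v w :: "nat \<Rightarrow> 'a" and k :: "nat \<Rightarrow> nat"
  assumes "\<And>i s. i < t \<Longrightarrow> s < k i \<Longrightarrow> v ((\<Sum>r<i. k r) + s) = w ((\<Sum>r<i. k r) + s)"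
    and "\<And>l. l \<ge> (\<Sum>i<t. k i) \<Longrightarrow> v l = w l"
  shows "v = w"
proof
  fix l
  show "v l = w l"
    using assms block_coordinate[of l k t] by (cases "l < (\<Sum>i<t. k i)") (metis, simp)
qed

lemma direct_sum_moore_space:
  assumes "\<forall>i<t. S i = moore_space q (k i) (F i)"
  shows "direct_sum t k S = moore_vector q t k ` {x. \<forall>i<t. x i \<in> F i}"
proof (intro equalityI subsetI)
  fix v assume "v \<in> direct_sum t k S"
  then obtain y where v: "v = (\<Sum>i<t. block_emb k i (y i))" and y: "\<forall>i<t. y i \<in> S i"
    by (auto simp: direct_sum_def)
  have "\<forall>i. \<exists>x. i < t \<longrightarrow> x \<in> F i \<and> y i = (\<lambda>j. if j < k i then x ^ q ^ j else 0)"
    using y assms by (auto simp: moore_space_def)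
  then obtain x where x: "\<And>i. i < t \<Longrightarrow> x i \<in> F i \<and> y i = (\<lambda>j. if j < k i then x i ^ q ^ j else 0)"
    by metis
  hence "v = moore_vector q t k x" unfolding v moore_vector_def by (intro sum.cong) auto
  with x show "v \<in> moore_vector q t k ` {x. \<forall>i<t. x i \<in> F i}" by blast
next
  fix v assume "v \<in> moore_vector q t k ` {x. \<forall>i<t. x i \<in> F i}"
  then obtain x where v: "v = moore_vector q t k x" and x: "\<forall>i<t. x i \<in> F i" by blast
  have "\<forall>i<t. (\<lambda>j. if j < k i then x i ^ q ^ j else 0) \<in> S i"
    using x assms by (auto simp: moore_space_def)
  thus "v \<in> direct_sum t k S" unfolding direct_sum_def v moore_vector_def
    by (intro CollectI exI[of _ "\<lambda>i j. if j < k i then x i ^ q ^ j else 0"]) auto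
qed

text \<open>
  A polynomial of degree at most \<open>q ^ (d - 1)\<close> cannot have \<open>q ^ n\<close> roots unless it is zero.
\<close>

lemma linearized_polynomial_roots:
  fixes K :: "'a::{field,finite} set"
  assumes q: "q > 1" and d: "d \<le> n" "card K = q ^ n"
    and zero: "\<And>x. x \<in> K \<Longrightarrow> (\<Sum>s<d. a s * x ^ q ^ s) = 0" and s: "s < d"
  shows "a s = 0"
proof -
  define p where "p = (\<Sum>s<d. monom (a s) (q ^ s))"
  have "q ^ s \<le> q ^ (d - 1)" if "s < d" for s
    using that q by (intro power_increasing) auto
  hence "degree p \<le> q ^ (d - 1)"
    unfolding p_def by (intro degree_sum_le) (auto intro: order.trans[OF degree_monom_le])
  also have "\<dots> < q ^ n" using q d s by (intro power_strict_increasing) auto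
  finally have deg: "degree p < card K" using d by simp
  have "p = 0"
    by (rule poly_eqI_degree[of K]) (use zero deg in \<open>auto simp: p_def poly_sum poly_monom\<close>)
  moreover have "coeff p (q ^ s) = a s"
  proof -
    have "coeff p (q ^ s) = (\<Sum>r<d. if r = s then a s else 0)"
      unfolding p_def coeff_sum by (rule sum.cong) (use q in auto)
    thus ?thesis using s by (simp add: sum.delta)
  qed
  ultimately show ?thesis by simp
qed

text \<open>
  A form vanishing on the span is tested on vectors concentrated in one block; there it becomes a
  linearized polynomial that vanishes on the whole of \<open>F i\<close>.
\<close>

lemma moore_vectors_span:
  fixes F :: "nat \<Rightarrow> 'a::{field,finite} set"
  assumes q: "q > 1" and k: "\<And>i. i < t \<Longrightarrow> k i \<le> n i"
    and F: "\<And>i. i < t \<Longrightarrow> 0 \<in> F i \<and> card (F i) = q ^ n i"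
  shows "module.span (ext_scale (\<lambda>x. x)) (moore_vector q t k ` {x. \<forall>i<t. x i \<in> F i})
    = full_space (\<Sum>i<t. k i)"
proof -
  interpret V: vector_space "ext_scale (\<lambda>x::'a. x)"
    by (rule vector_space_ext_scale[OF field_embedding_id])
  let ?M = "moore_vector q t k" let ?X = "{x. \<forall>i<t. x i \<in> F i}" let ?d = "\<Sum>i<t. k i"
  have M: "?M x \<in> full_space ?d" for x :: "nat \<Rightarrow> 'a"
    by (simp add: full_space_def moore_vector_outside)
  have "w \<in> V.span (?M ` ?X)" if w: "w \<in> full_space ?d" for w
  proof (rule ccontr)
    assume "w \<notin> V.span (?M ` ?X)"
    from proper_subspace_annihilator[OF V.subspace_span w this] obtain a
      where a: "\<And>v. v \<in> V.span (?M ` ?X) \<Longrightarrow> v \<in> full_space ?d \<Longrightarrow> (\<Sum>l<?d. a l * v l) = 0"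
        and aw: "(\<Sum>l<?d. a l * w l) = 1" by blast
    have "a ((\<Sum>r<i. k r) + s) = 0" if i: "i < t" and s: "s < k i" for i s
    proof (rule linearized_polynomial_roots[OF q k[OF i] conjunct2[OF F[OF i]] _ s,
          of "\<lambda>s. a ((\<Sum>r<i. k r) + s)"])
      fix y assume y: "y \<in> F i"
      define x where "x j = (if j = i then y else 0)" for j
      have "x \<in> ?X" using y F by (auto simp: x_def)
      hence "0 = (\<Sum>l<?d. a l * ?M x l)" using a[OF V.span_base M] by auto
      also have "\<dots> = (\<Sum>j<t. \<Sum>s<k j. a ((\<Sum>r<j. k r) + s) * x j ^ q ^ s)"
        by (simp add: sum_over_blocks moore_vector_nth)
      also have "\<dots> = (\<Sum>j<t. if j = i then \<Sum>s<k i. a ((\<Sum>r<i. k r) + s) * y ^ q ^ s else 0)"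
        by (intro sum.cong) (use q in \<open>auto simp: x_def power_0_left\<close>)
      also have "\<dots> = (\<Sum>s<k i. a ((\<Sum>r<i. k r) + s) * y ^ q ^ s)"
        using i by (simp add: sum.delta)
      finally show "(\<Sum>s<k i. a ((\<Sum>r<i. k r) + s) * y ^ q ^ s) = 0" by simp
    qed
    hence "(\<Sum>l<?d. a l * w l) = 0" by (simp add: sum_over_blocks)
    with aw show False by simp
  qed
  moreover have "V.span (?M ` ?X) \<subseteq> full_space ?d"
    using M subspace_full_space by (intro V.span_minimal) auto
  ultimately show ?thesis by blast
qed

text \<open>
  Frobenius is additive and fixes the base field, so coordinates depend linearly on the tuple; and
  each \<open>F i\<close>, being the fixed field of a Frobenius power, contains the base field.
\<close>

lemma moore_vectors_subspace:
  fixes e :: "'b::{field,finite} \<Rightarrow> 'a::{field,finite}"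
  assumes q: "q = CHAR('a) ^ r" "q = CARD('b)" and e: "field_embedding e"
    and F: "\<And>i. i < t \<Longrightarrow> is_subfield (F i) \<and> card (F i) = q ^ n i"
  shows "module.subspace (ext_scale e) (moore_vector q t k ` {x. \<forall>i<t. x i \<in> F i})"
proof -
  interpret V: vector_space "ext_scale e" using e by (rule vector_space_ext_scale)
  let ?M = "moore_vector q t k"
  have qpos: "q > 0" using q(2) by simp
  have F_fixed: "F i = {x. x ^ q ^ n i = x}" if "i < t" for i
    using subfield_eq_fixed_points F[OF that] by metis
  have add: "(x + y) ^ q ^ s = x ^ q ^ s + y ^ q ^ s" for x y :: 'a and s
    using frobenius_power_sum[OF q(1), where A="{True,False}" and f="\<lambda>b. if b then x else y" and h=s] by simp
  have ec: "e c ^ q ^ s = e c" for c s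
  proof -
    have "e c ^ q = e c" using embedded_field_eq_fixed_points[OF e] q(2) by auto
    thus ?thesis by (induction s) (simp_all add: power_mult)
  qed
  show ?thesis
  proof (rule V.subspaceI)
    have "?M (\<lambda>_. 0) = (0 :: nat \<Rightarrow> 'a)"
      by (rule block_ext[of t k]) (use qpos in \<open>simp_all add: moore_vector_nth moore_vector_outside power_0_left\<close>)
    moreover have "0 \<in> F i" if "i < t" for i using F that by (simp add: is_subfield_def)
    ultimately show "0 \<in> ?M ` {x. \<forall>i<t. x i \<in> F i}" by (intro image_eqI[of _ _ "\<lambda>_. 0"]) auto
  next
    fix v w assume "v \<in> ?M ` {x. \<forall>i<t. x i \<in> F i}" "w \<in> ?M ` {x. \<forall>i<t. x i \<in> F i}"
    then obtain x y where x: "\<forall>i<t. x i \<in> F i" "v = ?M x" and y: "\<forall>i<t. y i \<in> F i" "w = ?M y"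
      by blast
    have "v + w = ?M (\<lambda>i. x i + y i)" unfolding x y
      by (rule block_ext[of t k]) (simp_all add: moore_vector_nth moore_vector_outside add)
    thus "v + w \<in> ?M ` {x. \<forall>i<t. x i \<in> F i}" using x y by (auto simp: F_fixed add)
  next
    fix c v assume "v \<in> ?M ` {x. \<forall>i<t. x i \<in> F i}"
    then obtain x where x: "\<forall>i<t. x i \<in> F i" "v = ?M x" by blast
    have "ext_scale e c v = ?M (\<lambda>i. e c * x i)" unfolding x
      by (rule block_ext[of t k])
        (simp_all add: ext_scale_def moore_vector_nth moore_vector_outside power_mult_distrib ec)
    thus "ext_scale e c v \<in> ?M ` {x. \<forall>i<t. x i \<in> F i}"
      using x by (auto simp: F_fixed power_mult_distrib ec)
  qed
qed

text \<open>
  Every block is nonempty, so a tuple is recovered from the first coordinate of each block.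
\<close>

lemma card_moore_vectors:
  fixes F :: "nat \<Rightarrow> 'a::field set"
  assumes k: "\<And>i. i < t \<Longrightarrow> k i > 0"
  shows "card (moore_vector q t k ` {x. \<forall>i<t. x i \<in> F i}) = (\<Prod>i<t. card (F i))"
proof -
  have restrict: "moore_vector q t k x = moore_vector q t k (restrict x {..<t})" for x :: "nat \<Rightarrow> 'a"
    unfolding moore_vector_def by (rule sum.cong[OF refl]) (simp cong: if_cong)
  have "moore_vector q t k x \<in> moore_vector q t k ` (\<Pi>\<^sub>E i\<in>{..<t}. F i)" if "\<forall>i<t. x i \<in> F i" for x
    by (rule image_eqI[where x = "restrict x {..<t}"], rule restrict, use that in auto)
  moreover have "(\<Pi>\<^sub>E i\<in>{..<t}. F i) \<subseteq> {x. \<forall>i<t. x i \<in> F i}" by auto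
  ultimately have "moore_vector q t k ` {x. \<forall>i<t. x i \<in> F i} = moore_vector q t k ` (\<Pi>\<^sub>E i\<in>{..<t}. F i)"
    by blast
  moreover have "inj_on (moore_vector q t k) (\<Pi>\<^sub>E i\<in>{..<t}. F i)"
  proof (rule inj_onI)
    fix x y assume xy: "x \<in> (\<Pi>\<^sub>E i\<in>{..<t}. F i)" "y \<in> (\<Pi>\<^sub>E i\<in>{..<t}. F i)"
      and eq: "moore_vector q t k x = moore_vector q t k y"
    have "x i = y i" if "i < t" for i
      using fun_cong[OF eq, of "(\<Sum>r<i. k r) + 0"]
        moore_vector_nth[where q = q and k = k and x = x, OF that k[OF that]]
        moore_vector_nth[where q = q and k = k and x = y, OF that k[OF that]]
      by simp
    with xy show "x = y" by (intro PiE_ext) auto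
  qed
  ultimately show ?thesis by (simp add: card_image card_PiE)
qed

section \<open>Evasiveness\<close>

text \<open>
  A dependence over the large field descends to one over the fixed points of Frobenius, and these are
  the image of \<open>e\<close>.
\<close>

lemma independent_over_extension:
  fixes e :: "'b::{field,finite} \<Rightarrow> 'a::{field,finite}"
  assumes q: "q = CHAR('a) ^ r" "q = CARD('b)" and e: "field_embedding e"
    and card: "CARD('a) = q ^ (\<Prod>i<t. n i)"
    and coprime: "\<forall>i<t. \<forall>j<t. i \<noteq> j \<longrightarrow> coprime (n i) (n j)"
    and n: "\<And>i. i < t \<Longrightarrow> n i > 0" and k: "\<And>i. i < t \<Longrightarrow> k i > 0"
    and F: "\<And>i. i < t \<Longrightarrow> is_subfield (F i) \<and> card (F i) = q ^ n i"
    and a: "\<And>i. i < t \<Longrightarrow> \<exists>s<k i. a ((\<Sum>r<i. k r) + s) \<noteq> 0"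
    and B: "B \<subseteq> moore_vector q t k ` {x. \<forall>i<t. x i \<in> F i}"
    and kernel: "\<And>v. v \<in> B \<Longrightarrow> (\<Sum>l<\<Sum>i<t. k i. a l * v l) = 0"
    and indep: "\<not> module.dependent (ext_scale e) B" and fin: "finite B"
  shows "\<not> module.dependent (ext_scale (\<lambda>x. x)) B"
proof
  interpret E: vector_space "ext_scale e" using e by (rule vector_space_ext_scale)
  interpret V: vector_space "ext_scale (\<lambda>x::'a. x)"
    by (rule vector_space_ext_scale[OF field_embedding_id])
  assume "V.dependent B"
  then obtain c0 v0 where c0: "v0 \<in> B" "c0 v0 \<noteq> 0" "(\<Sum>v\<in>B. ext_scale (\<lambda>x. x) (c0 v) v) = 0"
    using V.dependent_finite[OF fin] by auto
  have "\<forall>v\<in>B. \<exists>x. v = moore_vector q t k x \<and> (\<forall>i<t. x i \<in> F i)" using B by blast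
  then obtain x where x: "\<And>v. v \<in> B \<Longrightarrow> v = moore_vector q t k (x v)"
      "\<And>v i. v \<in> B \<Longrightarrow> i < t \<Longrightarrow> x v i \<in> F i"
    by metis
  have coord: "v ((\<Sum>r<i. k r) + s) = x v i ^ q ^ s" if "v \<in> B" "i < t" "s < k i" for v i s
    using moore_vector_nth[where q = q and k = k and x = "x v", OF that(2,3)] x(1)[OF that(1)] by simp
  have UNIV: "is_subfield (UNIV :: 'a set)" by (simp add: is_subfield_def)
  have "\<exists>c. (\<exists>v\<in>B. c v \<noteq> 0) \<and> (\<forall>v\<in>B. c v ^ q = c v) \<and>
    (\<forall>j<t. \<forall>s<k j. (\<Sum>v\<in>B. c v * x v j ^ q ^ s) = 0)"
  proof (rule relation_over_base_field[OF q(1) coprime n _ k])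
    show "y ^ q ^ (\<Prod>i<t. n i) = y" for y :: 'a
      using subfield_power_card[OF UNIV, of y] card by simp
    show "x v i ^ q ^ n i = x v i" if "v \<in> B" "i < t" for v i
      using subfield_power_card[OF _ x(2)[OF that]] F[OF that(2)] by metis
    show "(\<Sum>i<t. \<Sum>s<k i. a ((\<Sum>r<i. k r) + s) * x v i ^ q ^ s) = 0" if "v \<in> B" for v
      using kernel[OF that] coord[OF that] by (simp add: sum_over_blocks)
    show "(\<Sum>v\<in>B. c0 v * x v j ^ q ^ s) = 0" if "j < t" "s < k j" for j s
      using fun_cong[OF c0(3), of "(\<Sum>r<j. k r) + s"] coord that
      by (simp add: sum_fun_apply ext_scale_def)
  qed (use a fin c0 in auto)
  then obtain c v1 where c: "v1 \<in> B" "c v1 \<noteq> 0" "\<And>v. v \<in> B \<Longrightarrow> c v ^ q = c v"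
    "\<And>j s. j < t \<Longrightarrow> s < k j \<Longrightarrow> (\<Sum>v\<in>B. c v * x v j ^ q ^ s) = 0"
    by blast
  have "\<forall>v\<in>B. \<exists>b. c v = e b"
    using embedded_field_eq_fixed_points[OF e] c(3) q(2) by blast
  then obtain b where b: "\<And>v. v \<in> B \<Longrightarrow> c v = e (b v)" by metis
  have "(\<Sum>v\<in>B. ext_scale e (b v) v) = 0"
  proof (rule block_ext[of t k])
    show "(\<Sum>v\<in>B. ext_scale e (b v) v) ((\<Sum>r<i. k r) + s) = 0 ((\<Sum>r<i. k r) + s)"
      if "i < t" "s < k i" for i s
      using c(4)[OF that] coord[OF _ that] by (simp add: sum_fun_apply ext_scale_def flip: b)
    show "(\<Sum>v\<in>B. ext_scale e (b v) v) l = 0 l" if "(\<Sum>i<t. k i) \<le> l" for l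
    proof -
      have "v l = 0" if "v \<in> B" for v
        using moore_vector_outside[OF \<open>(\<Sum>i<t. k i) \<le> l\<close>, of q "x v"] x(1)[OF that] by simp
      thus ?thesis by (auto simp: sum_fun_apply ext_scale_def intro!: sum.neutral)
    qed
  qed
  from E.independentD[OF indep fin subset_refl this c(1)] have "b v1 = 0" .
  moreover have "e 0 = 0" using e unfolding field_embedding_def by (metis add_cancel_right_right)
  ultimately show False using b[OF c(1)] c(2) by simp
qed

theorem theorem3p1:
  fixes e :: "'b::{field,finite} \<Rightarrow> 'a::{field,finite}"
    and q t m :: nat
    and k n :: "nat \<Rightarrow> nat"
    and F :: "nat \<Rightarrow> 'a set"
    and S :: "nat \<Rightarrow> (nat \<Rightarrow> 'a) set"
  assumes "primepow q"
    and "t > 0"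
    and "\<forall>i<t. 0 < k i \<and> 0 < n i"
    and "\<forall>i<t. \<forall>j<t. i \<noteq> j \<longrightarrow> gcd (n i) (n j) = 1"
    and "\<forall>i<t. k i < n i"
    and "m = (\<Prod>i<t. n i)"
    and "CARD('b) = q"
    and "CARD('a) = q ^ m"
    and "field_embedding e"
    and "\<forall>i<t. is_subfield (F i) \<and> card (F i) = q ^ n i"
    and "\<forall>i<t. S i = moore_space q (k i) (F i)"
  shows "is_system e (\<Sum>i<t. n i) (\<Sum>i<t. k i) (direct_sum t k S)
     \<and> evasive e (Lambda_spaces ((\<Sum>i<t. k i) - 1) t k) ((\<Sum>i<t. k i) - 1) (direct_sum t k S)"
proof
  interpret E: vector_space "ext_scale e" using assms(9) by (rule vector_space_ext_scale)
  interpret V: vector_space "ext_scale (\<lambda>x::'a. x)"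
    by (rule vector_space_ext_scale[OF field_embedding_id])
  define d where "d = (\<Sum>i<t. k i)"
  define W where "W = moore_vector q t k ` {x. \<forall>i<t. x i \<in> F i}"
  have W: "direct_sum t k S = W"
    unfolding W_def by (rule direct_sum_moore_space[OF assms(11)])
  obtain r where r: "q = CHAR('a) ^ r" using char_power_if_card[OF assms(1,8)] by blast
  have "card {0, 1::'b} \<le> CARD('b)" by (rule card_mono) auto
  hence q1: "q > 1" using assms(7) by simp
  have W_full: "W \<subseteq> full_space d"
    by (auto simp: W_def d_def full_space_def moore_vector_outside)
  have sub: "E.subspace W"
    unfolding W_def
    by (rule moore_vectors_subspace[OF r assms(7)[symmetric] assms(9)]) (use assms(10) in auto)
  have "card W = (\<Prod>i<t. card (F i))"
    unfolding W_def by (rule card_moore_vectors) (use assms(3) in auto)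
  also have "\<dots> = q ^ (\<Sum>i<t. n i)"
    unfolding power_sum by (rule prod.cong) (use assms(10) in auto)
  finally have "q ^ E.dim W = q ^ (\<Sum>i<t. n i)"
    using card_subspace[OF assms(9) sub] finite_subset[OF W_full finite_full_space] assms(7) by simp
  hence dim: "E.dim W = (\<Sum>i<t. n i)" using q1 power_inject_exp by blast
  have span: "V.span W = full_space d"
    unfolding W_def d_def
  proof (rule moore_vectors_span[OF q1])
    show "k i \<le> n i" if "i < t" for i using assms(5) that by (simp add: less_imp_le)
    show "0 \<in> F i \<and> card (F i) = q ^ n i" if "i < t" for i
      using assms(10) that by (simp add: is_subfield_def)
  qed
  show "is_system e (\<Sum>i<t. n i) (\<Sum>i<t. k i) (direct_sum t k S)"
    unfolding is_system_def W using W_full sub dim span by (simp add: d_def)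
  show "evasive e (Lambda_spaces ((\<Sum>i<t. k i) - 1) t k) ((\<Sum>i<t. k i) - 1) (direct_sum t k S)"
    unfolding evasive_def W
  proof
    fix A :: "(nat \<Rightarrow> 'a) set"
    assume A: "A \<in> Lambda_spaces ((\<Sum>i<t. k i) - 1) t k"
    have "k 0 \<le> (\<Sum>i<t. k i)" using assms(2) by (intro member_le_sum) auto
    hence "(\<Sum>i<t. k i) > 0" using assms(2,3) by (metis gr0I leD)
    from Lambda_space_annihilator[OF A this assms(2)] obtain a
      where a: "\<And>v. v \<in> A \<Longrightarrow> (\<Sum>l<\<Sum>i<t. k i. a l * v l) = 0"
        "\<And>i. i < t \<Longrightarrow> \<exists>s<k i. a ((\<Sum>r<i. k r) + s) \<noteq> 0"
      by blast
    obtain B where B: "B \<subseteq> W \<inter> A" "E.independent B" "card B = E.dim (W \<inter> A)"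
      using E.basis_exists by metis
    have fin: "finite B" using B(1) W_full finite_full_space by (meson Int_subset_iff finite_subset)
    have "V.independent B"
    proof (rule independent_over_extension[OF r assms(7)[symmetric] assms(9)])
      show "CARD('a) = q ^ (\<Prod>i<t. n i)" using assms(6,8) by simp
      show "\<forall>i<t. \<forall>j<t. i \<noteq> j \<longrightarrow> coprime (n i) (n j)"
        using assms(4) by (simp add: coprime_iff_gcd_eq_1)
      show "B \<subseteq> moore_vector q t k ` {x. \<forall>i<t. x i \<in> F i}" using B(1) by (simp add: W_def)
      show "(\<Sum>l<\<Sum>i<t. k i. a l * v l) = 0" if "v \<in> B" for v using a(1) B(1) that by blast
    qed (use assms(3,10) a(2) B(2) fin in auto)
    moreover obtain C where C: "C \<subseteq> A" "A \<subseteq> V.span C" "card C = V.dim A"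
      using V.basis_exists by metis
    moreover have "A \<subseteq> full_space d" and dimA: "V.dim A = d - 1"
      using A by (auto simp: Lambda_spaces_def d_def)
    hence "finite C" using C(1) finite_full_space by (meson finite_subset)
    ultimately have "card B \<le> card C"
      using V.independent_span_bound[of C B] B(1) by blast
    thus "E.dim (W \<inter> A) \<le> (\<Sum>i<t. k i) - 1" using B(3) C(3) dimA by (simp add: d_def)
  qed
qed

end
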